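(* Assume $\clubsuit_C$. For any positive integers $k,m$ with $k$ dividing $m$, there is a principal $\mathbb{Z}_m$-bundle over $\omega_1$ of order $k$.
   Context: $\clubsuit_C$ is the axiom: there is a ladder system $\langle L_\alpha:\alpha\in\Lambda\rangle$ ($\Lambda$ the set of limit ordinals in $\omega_1$, each $L_\alpha$ a strictly increasing $\omega$-sequence of ordinals with limit $\alpha$) such that for each club (closed unbounded) $C\subset\omega_1$ the set $\{\alpha\in\Lambda:L_\alpha\subset C\}$ is stationary. For $m\ge1$ identify $m$ with $\{0,\dots,m-1\}$ and let $\pi:\omega_1\times m\to\omega_1$ be the projection. A closed $m$-to-$1$ preimage of $\omega_1$ (an $m$-cp$\omega_1$) is the set $\omega_1\times m$ endowed with a Hausdorff topology such that $\pi$ is a closed continuous map onto $\omega_1$ (order topology). An $m$-cp$\omega_1$ $K$ is a principal $\mathbb{Z}_m$-bundle over $\omega_1$ if there is a continuous action of $\mathbb{Z}_m$ (integers modulo $m$) on $K$ leaving each fiber $\pi^{-1}(\{\alpha\})$ invariant and free and transitive on each fiber. A subset $E\subset K$ is club if it is closed and $\pi(E)$ is unbounded in $\omega_1$. The order of $K$ is the smallest $j$ for which there is a club $E\subset K$ such that $|E\cap(\{\alpha\}\times m)|=j$ for each $\alpha\in\pi(E)$. *)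

theory Defs
  imports
    "HOL-Analysis.Analysis"
    "HOL-Algebra.Elementary_Groups"
    "HOL-Algebra.Group_Action"
    "HOL-Library.Countable_Set_Type"
begin

(* omega_1 is realised as the initial well-order of cardinality aleph_1; the two lemmas
   uncountable_omega1 and countable_lessThan_omega1 below characterise its order type. *)

typedef omega1 = "Field (cardSuc natLeq)"
proof -
  have "infinite (Field (cardSuc natLeq))"
    using cardSuc_finite[OF natLeq_Card_order] Field_natLeq by simp
  then show ?thesis
    by (metis ex_in_conv finite.emptyI)
qed

lemma Well_order_cardSuc_natLeq: "Well_order (cardSuc natLeq)"
  using cardSuc_Card_order[OF natLeq_Card_order] card_order_on_well_order_on by blast

instantiation omega1 :: linorder
begin

definition less_eq_omega1 :: "omega1 \<Rightarrow> omega1 \<Rightarrow> bool"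
  where "x \<le> y \<longleftrightarrow> (Rep_omega1 x, Rep_omega1 y) \<in> cardSuc natLeq"

definition less_omega1 :: "omega1 \<Rightarrow> omega1 \<Rightarrow> bool"
  where "x < y \<longleftrightarrow> x \<le> y \<and> \<not> y \<le> (x::omega1)"

instance
proof -
  have lin: "Linear_order (cardSuc natLeq)"
    using Well_order_cardSuc_natLeq by (simp add: well_order_on_def)
  note d = lin[unfolded linear_order_on_def partial_order_on_def preorder_on_def]
  show "OFCLASS(omega1, linorder_class)"
  proof
    fix x y z :: omega1
    show "x < y \<longleftrightarrow> x \<le> y \<and> \<not> y \<le> x"
      by (rule less_omega1_def)
    show "x \<le> x"
      unfolding less_eq_omega1_def using d Rep_omega1[of x] by (meson refl_onD)
    show "x \<le> z" if "x \<le> y" "y \<le> z"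
      using that d unfolding less_eq_omega1_def by (meson transD)
    show "x = y" if "x \<le> y" "y \<le> x"
      using that d unfolding less_eq_omega1_def by (meson Rep_omega1_inject antisymD)
    show "x \<le> y \<or> y \<le> x"
      unfolding less_eq_omega1_def using d Rep_omega1[of x] Rep_omega1[of y]
        \<open>x \<le> x\<close>[unfolded less_eq_omega1_def]
      by (metis total_on_def)
  qed
qed

end

lemma less_omega1_iff:
  "x < y \<longleftrightarrow> (Rep_omega1 x, Rep_omega1 y) \<in> cardSuc natLeq - Id"
  unfolding less_le less_eq_omega1_def by (auto simp: Rep_omega1_inject)

instance omega1 :: wellorder
proof
  fix P :: "omega1 \<Rightarrow> bool" and a :: omega1
  assume step: "\<And>x. (\<And>y. y < x \<Longrightarrow> P y) \<Longrightarrow> P x"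
  have "wf (cardSuc natLeq - Id)"
    using Well_order_cardSuc_natLeq by (simp add: well_order_on_def)
  then have "wf (inv_image (cardSuc natLeq - Id) Rep_omega1)"
    by (rule wf_inv_image)
  then show "P a"
  proof (induction a rule: wf_induct_rule)
    case (less x)
    then show ?case
      using step by (simp add: less_omega1_iff inv_image_def)
  qed
qed

lemma uncountable_omega1:
  includes cardinal_syntax
  shows "uncountable (UNIV :: omega1 set)"
proof
  assume "countable (UNIV :: omega1 set)"
  then have "countable (Field (cardSuc natLeq))"
    by (metis countable_image type_definition.Rep_range type_definition_omega1)
  then have "|Field (cardSuc natLeq)| \<le>o natLeq"
    by (simp add: countable_card_le_natLeq)
  then have "cardSuc natLeq \<le>o natLeq"
    using card_of_Field_ordIso[OF cardSuc_Card_order[OF natLeq_Card_order]]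
    by (metis ordIso_ordLeq_trans ordIso_symmetric)
  then show False
    using cardSuc_greater[OF natLeq_Card_order] not_ordLess_ordLeq by blast
qed

lemma countable_lessThan_omega1:
  includes cardinal_syntax
  shows "countable {..<a :: omega1}"
proof -
  have "|underS (cardSuc natLeq) (Rep_omega1 a)| <o cardSuc natLeq"
    using card_of_underS[OF cardSuc_Card_order[OF natLeq_Card_order]] Rep_omega1 by blast
  then have "|underS (cardSuc natLeq) (Rep_omega1 a)| \<le>o natLeq"
    using cardSuc_ordLeq_ordLess[OF natLeq_Card_order card_of_Card_order] by blast
  then have "countable (underS (cardSuc natLeq) (Rep_omega1 a))"
    by (simp add: countable_card_le_natLeq)
  moreover have "Rep_omega1 ` {..<a} \<subseteq> underS (cardSuc natLeq) (Rep_omega1 a)"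
    by (auto simp: underS_def less_omega1_iff)
  ultimately have "countable (Rep_omega1 ` {..<a})"
    using countable_subset by blast
  then show ?thesis
    by (simp add: countable_image_inj_eq inj_on_def Rep_omega1_inject)
qed

instantiation omega1 :: linorder_topology
begin

definition open_omega1 :: "omega1 set \<Rightarrow> bool"
  where "open_omega1 = generate_topology (range (\<lambda>a. {..<a}) \<union> range (\<lambda>a. {a<..}))"

instance
  by standard (rule open_omega1_def)

end

definition unbounded_omega1 :: "omega1 set \<Rightarrow> bool"
  where "unbounded_omega1 C \<longleftrightarrow> (\<forall>a. \<exists>b\<in>C. a < b)"

definition club_omega1 :: "omega1 set \<Rightarrow> bool"
  where "club_omega1 C \<longleftrightarrow> closed C \<and> unbounded_omega1 C"

definition stationary_omega1 :: "omega1 set \<Rightarrow> bool"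
  where "stationary_omega1 S \<longleftrightarrow> (\<forall>C. club_omega1 C \<longrightarrow> S \<inter> C \<noteq> {})"

(* 0 is not counted as a limit ordinal: it carries no strictly increasing sequence. *)
definition limit_ordinals :: "omega1 set"
  where "limit_ordinals = {a. (\<exists>b. b < a) \<and> (\<forall>b<a. \<exists>c. b < c \<and> c < a)}"

definition ladder_system :: "(omega1 \<Rightarrow> nat \<Rightarrow> omega1) \<Rightarrow> bool"
  where "ladder_system L \<longleftrightarrow> (\<forall>a\<in>limit_ordinals. strict_mono (L a) \<and> L a \<longlonglongrightarrow> a)"

definition clubsuit_C :: bool
  where "clubsuit_C \<longleftrightarrow>
    (\<exists>L. ladder_system L \<and>
         (\<forall>C. club_omega1 C \<longrightarrow> stationary_omega1 {a \<in> limit_ordinals. range (L a) \<subseteq> C}))"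

definition fiber :: "nat \<Rightarrow> omega1 \<Rightarrow> (omega1 \<times> nat) set"
  where "fiber m a = {a} \<times> {..<m}"

(* "cp" abbreviates "closed preimage"; surjectivity of fst rules out m = 0. *)
definition cp_omega1 :: "nat \<Rightarrow> (omega1 \<times> nat) topology \<Rightarrow> bool"
  where "cp_omega1 m K \<longleftrightarrow>
    topspace K = UNIV \<times> {..<m} \<and> Hausdorff_space K \<and>
    continuous_map K euclidean fst \<and> closed_map K euclidean fst \<and>
    fst ` topspace K = UNIV"

definition principal_Zm_bundle :: "nat \<Rightarrow> (omega1 \<times> nat) topology \<Rightarrow> bool"
  where "principal_Zm_bundle m K \<longleftrightarrow>
    cp_omega1 m K \<and>
    (\<exists>\<phi>. group_action (integer_mod_group m) (topspace K) \<phi> \<and>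
         continuous_map
           (prod_topology (discrete_topology (carrier (integer_mod_group m))) K) K
           (\<lambda>(g, x). \<phi> g x) \<and>
         (\<forall>a. (\<forall>g\<in>carrier (integer_mod_group m). \<phi> g ` fiber m a = fiber m a) \<and>
              (\<forall>g\<in>carrier (integer_mod_group m). \<forall>x\<in>fiber m a.
                 \<phi> g x = x \<longrightarrow> g = \<one>\<^bsub>integer_mod_group m\<^esub>) \<and>
              (\<forall>x\<in>fiber m a. \<forall>y\<in>fiber m a.
                 \<exists>g\<in>carrier (integer_mod_group m). \<phi> g x = y)))"

definition club_in :: "(omega1 \<times> nat) topology \<Rightarrow> (omega1 \<times> nat) set \<Rightarrow> bool"
  where "club_in K E \<longleftrightarrow> closedin K E \<and> unbounded_omega1 (fst ` E)"

(* The minimum exists for every m-cp of omega_1 with m > 0: E = topspace K witnesses j = m. *)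
definition cp_order :: "nat \<Rightarrow> (omega1 \<times> nat) topology \<Rightarrow> nat"
  where "cp_order m K =
    (LEAST j. \<exists>E. club_in K E \<and> (\<forall>a\<in>fst ` E. card (E \<inter> fiber m a) = j))"

end

theory Submission
  imports Defs
begin

text \<open>
  Locally, a principal \<open>\<int>\<^sub>m\<close>-bundle over \<open>\<omega>\<^sub>1\<close> is trivial. Over the initial segment up to \<open>a\<close> it
  is described by a function \<open>c a\<close> with values in \<open>\<int>\<^sub>m\<close>: the sheet through \<open>(a, i)\<close> consists of
  the points \<open>(z, i + c a z)\<close> with \<open>z \<le> a\<close>. Conversely, a family \<open>c\<close> glues to a bundle as soon as
  it is coherent: for \<open>x \<le> a\<close> the functions \<open>c a\<close> and \<open>c x\<close> differ by a constant on a left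
  neighbourhood of \<open>x\<close>. If all values are multiples of \<open>d\<close>, where \<open>m = d * k\<close>, then the points with
  second coordinate divisible by \<open>d\<close> form a club with fibres of size \<open>k\<close>; this bounds the order
  from above.

  For the lower bound, let \<open>E\<close> be a club with fibres \<open>F a\<close> of constant size over a club \<open>C\<close>. Since
  \<open>E\<close> is closed, \<open>F z = F a + c a z\<close> for all \<open>z \<in> C\<close> close to \<open>a\<close> on the left. One guessed ladder
  \<open>L t \<subseteq> C\<close> cannot refute this: all it says about \<open>E\<close> is that the fibres over the points of \<open>L t\<close>
  are eventually prescribed translates of \<open>F t\<close>, and nothing is known about \<open>F\<close> on \<open>L t\<close>. The
  contradiction comes from comparing a guessed \<open>t\<close> with a later \<open>a\<close>. Normalise \<open>c\<close> so that
  \<open>c t\<close> vanishes on a tail of \<open>L t\<close>; then \<open>F\<close> has the value \<open>F t\<close> on a tail of \<open>L t\<close>. By pressing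
  down, for unboundedly many guessed \<open>t\<close> this tail starts below one fixed \<open>b\<close>. Let \<open>a\<close> be a limit
  of such \<open>t\<close>. If the restriction of \<open>c a\<close> to the part of \<open>L t\<close> lying above \<open>b\<close> (and in the
  neighbourhood of \<open>a\<close> where the translation formula holds) takes the value \<open>c a t + d\<close> somewhere,
  then \<open>F t\<close> is invariant under translation by \<open>d\<close> and has at least \<open>k\<close> elements.

  So what is needed, for an arbitrary ladder system, is a coherent integer family \<open>f\<close> such that, for
  every \<open>a\<close> and \<open>x < a\<close>, all limit ordinals \<open>t < a\<close> close to \<open>a\<close> have a ladder point above \<open>x\<close> at
  which \<open>f a\<close> exceeds \<open>f a t\<close> by one (\<open>exists_coherent_family\<close>). It is defined by walking down
  along the ladders from \<open>a\<close> to \<open>z\<close> while remembering a lower bound \<open>b\<close>, and adding one exactly at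
  those steps that do not raise the bound. The proof that the jumps exist (\<open>twist_jump\<close>) is an
  induction on \<open>a\<close> which gives the stronger result that, for any \<open>b < t \<le> a\<close>, the walk with
  bound \<open>b\<close> has a jump at a ladder point of \<open>t\<close> above \<open>b\<close>.
\<close>

section \<open>The space of countable ordinals\<close>

lemma omega1_exists_greater_countable:
  fixes A :: "omega1 set"
  assumes "countable A"
  shows "\<exists>b. \<forall>a\<in>A. a < b"
proof (rule ccontr)
  assume "\<not> (\<exists>b. \<forall>a\<in>A. a < b)"
  then have "(UNIV :: omega1 set) = (\<Union>a\<in>A. insert a {..<a})"
    by (auto simp: not_less le_less) 
  moreover have "countable (\<Union>a\<in>A. insert a {..<a})"
    using assms countable_lessThan_omega1 by auto
  ultimately show False
    using uncountable_omega1 by simp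
qed

lemma omega1_exists_greater: "\<exists>b::omega1. a < b"
  using omega1_exists_greater_countable[of "{a}"] by auto

lemma open_atMost_omega1: "open {..a::omega1}"
proof -
  define s where "s = (LEAST b. a < b)"
  have "a < s"
    unfolding s_def using omega1_exists_greater[of a] by (rule LeastI_ex)
  moreover have "x \<le> a" if "x < s" for x
    using not_less_Least[of x "\<lambda>b. a < b"] that by (auto simp: s_def)
  ultimately have "{..a} = {..<s}" by auto
  then show ?thesis by simp
qed

lemma at_left_least_omega1:
  fixes a :: omega1
  assumes "\<And>b. a \<le> b"
  shows "eventually P (at_left a)"
  using assms by (auto simp: eventually_at_filter less_le_not_le)

text \<open>Initial segments \<open>{..a}\<close> are open, so only the left side of a point matters. This makes openness
  in \<open>\<omega>\<^sub>1\<close> directly comparable with the definition of the bundle topology below.\<close>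

lemma open_omega1_iff_at_left:
  fixes V :: "omega1 set"
  shows "open V \<longleftrightarrow> (\<forall>a\<in>V. \<forall>\<^sub>F z in at_left a. z \<in> V)"
proof
  assume "open V"
  then show "\<forall>a\<in>V. \<forall>\<^sub>F z in at_left a. z \<in> V"
    by (metis eventually_at_topological)
next
  assume left: "\<forall>a\<in>V. \<forall>\<^sub>F z in at_left a. z \<in> V"
  show "open V"
  proof (rule Topological_Spaces.openI)
    fix a assume a: "a \<in> V"
    show "\<exists>T. open T \<and> a \<in> T \<and> T \<subseteq> V"
    proof (cases "\<exists>b. b < a")
      case True
      then obtain b where "b < a" "\<forall>z>b. z < a \<longrightarrow> z \<in> V"
        using left a by (metis eventually_at_left)
      then have "open ({b<..} \<inter> {..a})" "a \<in> {b<..} \<inter> {..a}" "{b<..} \<inter> {..a} \<subseteq> V"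
        using a open_atMost_omega1 by (auto simp: le_less)
      then show ?thesis by blast
    next
      case False
      then have "{..a} = {a}" by (auto simp: not_less intro: antisym)
      then show ?thesis using open_atMost_omega1[of a] a by auto
    qed
  qed
qed

lemma club_closure_points_omega1:
  fixes b :: "omega1 \<Rightarrow> omega1"
  shows "club_omega1 {d. \<forall>x<d. b x < d}"
  unfolding club_omega1_def
proof
  have "open (- {d. \<forall>x<d. b x < d})"
    unfolding open_omega1_iff_at_left
  proof
    fix d assume "d \<in> - {d. \<forall>x<d. b x < d}"
    then obtain x where x: "x < d" "d \<le> b x" by (auto simp: not_less)
    then have "\<forall>z>x. z < d \<longrightarrow> z \<in> - {d. \<forall>x<d. b x < d}"
      by (auto simp: not_less intro: less_imp_le)
    then show "\<forall>\<^sub>F z in at_left d. z \<in> - {d. \<forall>x<d. b x < d}"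
      using x(1) eventually_at_left by blast
  qed
  then show "closed {d. \<forall>x<d. b x < d}"
    by (simp add: closed_def)
  show "unbounded_omega1 {d. \<forall>x<d. b x < d}"
    unfolding unbounded_omega1_def
  proof
    fix a
    have "\<exists>c. \<forall>y\<in>insert x (b ` insert x {..<x}). y < c" for x
      by (intro omega1_exists_greater_countable) (simp add: countable_lessThan_omega1)
    then obtain s where "\<And>x. \<forall>y\<in>insert x (b ` insert x {..<x}). y < s x"
      by metis
    then have s: "\<And>x. x < s x" "\<And>x y. y \<le> x \<Longrightarrow> b y < s x"
      by (auto simp: le_less)
    \<comment> \<open>The supremum of the iterates of \<open>s\<close>, which dominates \<open>b\<close> below each point, is a closure point.\<close>
    define t where "t n = (s ^^ n) (s a)" for n
    have t_Suc: "t (Suc n) = s (t n)" for n by (simp add: t_def)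
    define d where "d = (LEAST d. \<forall>n. t n \<le> d)"
    have "\<exists>d. \<forall>n. t n \<le> d"
      using omega1_exists_greater_countable[of "range t"] less_imp_le by auto
    then have upper: "t n \<le> d" for n
      unfolding d_def by (rule LeastI2_ex) auto
    have "b x < d" if x: "x < d" for x
    proof -
      obtain n where "x < t n"
        using not_less_Least[of x "\<lambda>d. \<forall>n. t n \<le> d"] x
        unfolding d_def[symmetric] by (auto simp: not_le)
      then have "b x < t (Suc n)"
        by (simp add: t_Suc s(2) less_imp_le)
      then show ?thesis using upper less_le_trans by blast
    qed
    moreover have "a < d"
      using s(1)[of a] upper[of 0] by (simp add: t_def)
    ultimately show "\<exists>d\<in>{d. \<forall>x<d. b x < d}. a < d" by auto
  qed
qed

lemma exists_limit_point_omega1: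
  assumes "unbounded_omega1 T"
  shows "\<exists>d>a. \<forall>x<d. \<exists>t\<in>T. x < t \<and> t < d"
proof -
  obtain b where b: "\<And>x. b x \<in> T" "\<And>x. x < b x"
    using assms unfolding unbounded_omega1_def by metis
  obtain d where "a < d" "\<forall>x<d. b x < d"
    using club_closure_points_omega1[of b]
    unfolding club_omega1_def unbounded_omega1_def by blast
  then show ?thesis using b by metis
qed

text \<open>A weak form of the pressing-down lemma: otherwise the points \<open>x\<close> with \<open>g x \<le> c\<close> would be bounded
  by some \<open>b c\<close>, and \<open>g\<close> could not be regressive at a closure point of \<open>b\<close>.\<close>

lemma regressive_bounded_unbounded:
  assumes "stationary_omega1 S" and regressive: "\<And>x. x \<in> S \<Longrightarrow> g x < x"
  shows "\<exists>c. unbounded_omega1 {x \<in> S. g x \<le> c}"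
proof (rule ccontr)
  assume "\<not> ?thesis"
  then have "\<exists>b. \<forall>x\<in>S. g x \<le> c \<longrightarrow> x \<le> b" for c
    unfolding unbounded_omega1_def by (simp add: not_less) blast
  then obtain b where b: "\<And>c. \<forall>x\<in>S. g x \<le> c \<longrightarrow> x \<le> b c"
    by metis
  obtain x where "x \<in> S" "\<forall>y<x. b y < x"
    using assms(1) club_closure_points_omega1[of b]
    unfolding stationary_omega1_def by blast
  then show False
    using b[of "g x"] regressive[of x] by (auto simp: not_less[symmetric])
qed

section \<open>A coherent family of integer functions\<close>

text \<open>The ladder at \<open>a\<close>, extended to successor ordinals, whose only rung is the predecessor, and to the
  least ordinal, which has none. Thus a walk can go down from every \<open>a\<close> to every \<open>x < a\<close>.\<close>

definition rungs :: "(omega1 \<Rightarrow> nat \<Rightarrow> omega1) \<Rightarrow> omega1 \<Rightarrow> omega1 set"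
  where "rungs L a = (if a \<in> limit_ordinals then range (L a)
                      else {p. p < a \<and> (\<forall>c>p. \<not> c < a)})"

definition next_rung :: "(omega1 \<Rightarrow> nat \<Rightarrow> omega1) \<Rightarrow> omega1 \<Rightarrow> omega1 \<Rightarrow> omega1"
  where "next_rung L a x = (LEAST r. r \<in> rungs L a \<and> x \<le> r)"

text \<open>The walk from \<open>a\<close> down to \<open>x\<close> steps to the least rung above or at \<open>x\<close>. If some rung lies strictly
  between the bound \<open>b\<close> and \<open>x\<close>, the last such rung becomes the new bound; otherwise the bound stays
  and the step is counted. The guard \<open>next_rung L a x < a\<close> makes the recursion terminate for every \<open>L\<close>.\<close>

function twist :: "(omega1 \<Rightarrow> nat \<Rightarrow> omega1) \<Rightarrow> omega1 \<Rightarrow> omega1 \<Rightarrow> omega1 \<Rightarrow> int" where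
  "twist L b a x =
    (if x < a \<and> next_rung L a x < a then
       (if \<exists>r\<in>rungs L a. b < r \<and> r < x
        then twist L (Max {r \<in> rungs L a. r < x}) (next_rung L a x) x
        else twist L b (next_rung L a x) x + 1)
     else 0)"
  by pat_completeness auto
termination
  by (relation "inv_image {(x, y). x < y} (\<lambda>(L, b, a, x). a)") (auto intro: wf_inv_image wf)

declare twist.simps [simp del]

lemma ladder_less:
  assumes "ladder_system L" "a \<in> limit_ordinals"
  shows "L a n < a"
proof -
  have L: "strict_mono (L a)" "L a \<longlonglongrightarrow> a"
    using assms by (auto simp: ladder_system_def)
  have "L a (Suc n) \<le> a"
    using L by (intro incseq_le strict_mono_mono)
  moreover have "L a n < L a (Suc n)"
    using L(1) by (simp add: strict_mono_less)
  ultimately show ?thesis by simp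
qed

lemma ladder_eventually_greater:
  assumes "ladder_system L" "a \<in> limit_ordinals" "x < a"
  shows "\<forall>\<^sub>F n in sequentially. x < L a n"
  using assms by (auto simp: ladder_system_def intro: order_tendstoD)

lemma ladder_exists_greater:
  assumes "ladder_system L" "a \<in> limit_ordinals" "x < a"
  obtains n where "x < L a n"
  using eventually_happens[OF ladder_eventually_greater[OF assms]] by auto

lemma rungs_less: "ladder_system L \<Longrightarrow> r \<in> rungs L a \<Longrightarrow> r < a"
  using ladder_less by (auto simp: rungs_def split: if_splits)

lemma exists_rung_ge:
  assumes "ladder_system L" "x < a"
  shows "\<exists>r\<in>rungs L a. x \<le> r"
proof (cases "a \<in> limit_ordinals")
  case True
  then show ?thesis
    using ladder_exists_greater[OF assms(1) True assms(2)]
    by (auto simp: rungs_def intro: less_imp_le)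
next
  case False
  then obtain p where "p < a" "\<forall>c. p < c \<longrightarrow> \<not> c < a"
    using assms(2) by (auto simp: limit_ordinals_def)
  then show ?thesis
    using False assms(2) by (auto simp: rungs_def intro: leI)
qed

lemma finite_rungs_below:
  assumes "ladder_system L" "x < a"
  shows "finite {r \<in> rungs L a. r < x}"
proof (cases "a \<in> limit_ordinals")
  case True
  obtain N where "\<And>n. N \<le> n \<Longrightarrow> x < L a n"
    using ladder_eventually_greater[OF assms(1) True assms(2)]
    by (auto simp: eventually_sequentially)
  then have "n < N" if "L a n < x" for n
    using that by (meson leI less_asym)
  then have "{r \<in> rungs L a. r < x} \<subseteq> L a ` {..<N}"
    using True by (auto simp: rungs_def)
  then show ?thesis using finite_surj by blast
next
  case False
  then have "rungs L a \<subseteq> {p}" if "p \<in> rungs L a" for p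
    using that by (auto simp: rungs_def) (meson not_less_iff_gr_or_eq)
  then have "finite (rungs L a)"
    by (metis finite.emptyI finite.insertI finite_subset subsetI empty_iff)
  then show ?thesis by simp
qed

lemma next_rung:
  assumes "ladder_system L" "x < a"
  shows "next_rung L a x \<in> rungs L a" "x \<le> next_rung L a x" "next_rung L a x < a"
proof -
  have *: "next_rung L a x \<in> rungs L a \<and> x \<le> next_rung L a x"
    unfolding next_rung_def by (rule LeastI_ex) (use exists_rung_ge[OF assms] in blast)
  show "next_rung L a x \<in> rungs L a" "x \<le> next_rung L a x"
    using * by blast+
  show "next_rung L a x < a"
    using * rungs_less[OF assms(1)] by blast
qed

lemma next_rung_le: "r \<in> rungs L a \<Longrightarrow> x \<le> r \<Longrightarrow> next_rung L a x \<le> r"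
  unfolding next_rung_def by (intro Least_le) simp

lemma twist_top [simp]: "twist L b a a = 0"
  by (simp add: twist.simps)

lemma twist_step:
  assumes "ladder_system L" "x < a"
  shows "twist L b a x =
    (if \<exists>r\<in>rungs L a. b < r \<and> r < x
     then twist L (Max {r \<in> rungs L a. r < x}) (next_rung L a x) x
     else twist L b (next_rung L a x) x + 1)"
proof -
  have "x < a \<and> next_rung L a x < a"
    using next_rung(3)[OF assms] assms(2) by (rule conjI[rotated])
  then show ?thesis
    by (subst twist.simps) (simp only: if_True simp_thms)
qed

text \<open>The interval \<open>{b<..a}\<close> is cut by the rungs of \<open>a\<close> into blocks \<open>{b'<..v}\<close>. On the block of \<open>x\<close> the
  walk from \<open>a\<close> continues as the walk from \<open>v\<close> with bound \<open>b'\<close>, so there \<open>twist L b a\<close> is a translate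
  of \<open>twist L b' v\<close>. This reduces statements about \<open>a\<close> to statements about the smaller \<open>v\<close>.\<close>

lemma twist_block:
  assumes L: "ladder_system L" and "b < x" "x < a"
  obtains b' v c where "b \<le> b'" "b' < x" "x \<le> v" "v < a"
    "\<And>z. b' < z \<Longrightarrow> z \<le> v \<Longrightarrow> twist L b a z = twist L b' v z + c"
    "\<And>r. r \<in> rungs L a \<Longrightarrow> r < x \<Longrightarrow> r \<le> b'"
proof -
  define v where "v = next_rung L a x"
  define R where "R = {r \<in> rungs L a. r < x}"
  note v = next_rung[OF L assms(3), folded v_def]
  have v_le: "v \<le> r" if "r \<in> rungs L a" "x \<le> r" for r
    unfolding v_def using that by (rule next_rung_le)
  have R_iff: "{r \<in> rungs L a. r < z} = R" and next_v: "next_rung L a z = v"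
    if z: "z \<le> v" and R_z: "\<And>r. r \<in> R \<Longrightarrow> r < z" for z
  proof -
    have "r < x" if "r \<in> rungs L a" "r < z" for r
    proof (rule ccontr)
      assume "\<not> r < x"
      then have "v \<le> r" using v_le[OF that(1)] by (simp add: not_less)
      then show False using that(2) z by simp
    qed
    then show "{r \<in> rungs L a. r < z} = R"
      using R_z by (auto simp: R_def)
    note nz = next_rung[OF L le_less_trans[OF z v(3)]]
    have "x \<le> next_rung L a z"
      using nz(1,2) R_z[of "next_rung L a z"] by (auto simp: R_def not_less[symmetric])
    then have "v \<le> next_rung L a z"
      by (intro v_le nz)
    moreover have "next_rung L a z \<le> v"
      using v(1) z by (intro next_rung_le)
    ultimately show "next_rung L a z = v" by simp
  qed
  have step: "twist L b a z = (if \<exists>r\<in>R. b < r then twist L (Max R) v z else twist L b v z + 1)"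
    if z: "z \<le> v" and R_z: "\<And>r. r \<in> R \<Longrightarrow> r < z" for z
  proof -
    have "(\<exists>r\<in>rungs L a. b < r \<and> r < z) \<longleftrightarrow> (\<exists>r\<in>R. b < r)"
      using R_iff[OF that] by blast
    then show ?thesis
      using twist_step[OF L le_less_trans[OF z v(3)], of b]
      by (simp only: R_iff[OF that] next_v[OF that])
  qed
  show thesis
  proof (cases "\<exists>r\<in>R. b < r")
    case True
    then obtain r where r: "r \<in> R" "b < r" by blast
    have fin: "finite R" unfolding R_def using finite_rungs_below[OF L assms(3)] .
    have M_ge: "r \<le> Max R" if "r \<in> R" for r using fin that by (rule Max_ge)
    have M: "Max R \<in> R" using fin r(1) by (metis Max_in empty_iff)
    have b: "b < Max R" using r(2) M_ge[OF r(1)] by (rule less_le_trans)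
    show thesis
    proof (rule that[of "Max R" v 0])
      show "twist L b a z = twist L (Max R) v z + 0" if "Max R < z" "z \<le> v" for z
        using step[OF that(2) le_less_trans[OF M_ge that(1)]] True by simp
      show "Max R < x" using M by (simp add: R_def)
      show "r \<le> Max R" if "r \<in> rungs L a" "r < x" for r
        using that by (intro M_ge) (simp add: R_def)
    qed (use b v in auto)
  next
    case False
    then have R_le: "r \<le> b" if "r \<in> R" for r using that by (auto simp: not_less)
    show thesis
    proof (rule that[of b v 1])
      show "twist L b a z = twist L b v z + 1" if "b < z" "z \<le> v" for z
        using step[OF that(2) le_less_trans[OF R_le that(1)]] False by simp
      show "r \<le> b" if "r \<in> rungs L a" "r < x" for r
        using that by (intro R_le) (simp add: R_def)
    qed (use v assms in auto)
  qed
qed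

text \<open>Once \<open>z\<close> has passed a rung of \<open>a\<close> above \<open>b\<close>, the first step of the walk discards \<open>b\<close>.\<close>

lemma twist_base_eventually:
  assumes L: "ladder_system L" and "b < a" "b' < a"
  shows "\<forall>\<^sub>F z in at_left a. twist L b a z = twist L b' a z"
proof (cases "a \<in> limit_ordinals")
  case True
  have m: "max b b' < a" using assms by simp
  obtain n where n: "max b b' < L a n"
    using ladder_exists_greater[OF L True m] .
  then have r: "L a n \<in> rungs L a" "b < L a n" "b' < L a n" "L a n < a"
    using True ladder_less[OF L True] by (auto simp: rungs_def)
  have "twist L b a z = twist L b' a z" if "L a n < z" "z < a" for z
  proof -
    have "(\<exists>r\<in>rungs L a. b < r \<and> r < z)" "(\<exists>r\<in>rungs L a. b' < r \<and> r < z)"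
      using r that by blast+
    then show ?thesis
      using twist_step[OF L that(2), of b] twist_step[OF L that(2), of b'] by (simp only: if_True)
  qed
  then show ?thesis
    using eventually_at_left[OF r(4)] r(4) by blast
next
  case False
  then obtain p where "p < a" "\<forall>c. p < c \<longrightarrow> \<not> c < a"
    using assms(2) by (auto simp: limit_ordinals_def)
  then show ?thesis
    using eventually_at_left[of p a] by blast
qed

lemma twist_coherent:
  assumes L: "ladder_system L" and "b < x" "x \<le> a"
  shows "\<forall>\<^sub>F z in at_left x. twist L b a z = twist L b a x + twist L b x z"
  using assms(2,3)
proof (induction a arbitrary: b rule: less_induct)
  case (less a)
  show ?case
  proof (cases "x = a")
    case False
    then have "x < a" using less.prems by simp
    then obtain b' v c where B: "b \<le> b'" "b' < x" "x \<le> v" "v < a"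
      and eq: "\<And>z. b' < z \<Longrightarrow> z \<le> v \<Longrightarrow> twist L b a z = twist L b' v z + c"
      using twist_block[OF L less.prems(1)] by metis
    have "\<forall>\<^sub>F z in at_left x. b' < z \<and> z < x"
      using eventually_at_left[OF B(2)] B(2) by blast
    then show ?thesis
      using less.IH[OF B(4) B(2,3)] twist_base_eventually[OF L B(2) less.prems(1)]
      by eventually_elim (use eq B in auto)
  qed simp
qed

text \<open>The point of counting the steps that keep the bound. For \<open>x = a\<close>, the first rung of \<open>a\<close> above \<open>b\<close>
  is reached by one counted step, whereas the value at \<open>a\<close> itself is zero. For \<open>x < a\<close>, the induction
  hypothesis for the block of \<open>x\<close> even gives a ladder point inside that block, and translating by a
  constant does not affect a difference of values.\<close>

lemma twist_jump:
  assumes L: "ladder_system L" and "x \<in> limit_ordinals" "b < x" "x \<le> a"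
  shows "\<exists>n. b < L x n \<and> twist L b a (L x n) = twist L b a x + 1"
  using assms(3,4)
proof (induction a arbitrary: b rule: less_induct)
  case (less a)
  show ?case
  proof (cases "x = a")
    case False
    then have "x < a" using less.prems by simp
    then obtain b' v c where B: "b \<le> b'" "b' < x" "x \<le> v" "v < a"
      and eq: "\<And>z. b' < z \<Longrightarrow> z \<le> v \<Longrightarrow> twist L b a z = twist L b' v z + c"
      using twist_block[OF L less.prems(1)] by metis
    obtain n where n: "b' < L x n" "twist L b' v (L x n) = twist L b' v x + 1"
      using less.IH[OF B(4) B(2,3)] by blast
    have "L x n < x" using ladder_less[OF L assms(2)] .
    then show ?thesis
      using n eq[of x] eq[of "L x n"] B by (intro exI[of _ n]) auto
  next
    case True
    then have a: "a \<in> limit_ordinals" "b < a" using assms(2) less.prems by auto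
    define n where "n = (LEAST n. b < L a n)"
    have n: "b < L a n"
      unfolding n_def by (rule LeastI_ex) (use ladder_exists_greater[OF L a] in blast)
    have before: "L a i \<le> b" if "L a i < L a n" for i
    proof -
      have "strict_mono (L a)" using L a(1) by (simp add: ladder_system_def)
      then have "i < n" using that by (simp add: strict_mono_less)
      then show ?thesis using not_less_Least[of i "\<lambda>n. b < L a n"] by (simp add: n_def not_less)
    qed
    have rung: "L a n \<in> rungs L a" using a by (simp add: rungs_def)
    then have "next_rung L a (L a n) = L a n"
      using next_rung(2)[OF L ladder_less[OF L a(1)], of n] next_rung_le[OF rung order_refl]
      by simp
    moreover have "\<not> (\<exists>r\<in>rungs L a. b < r \<and> r < L a n)"
      using before a(1) by (auto simp: rungs_def not_less)
    ultimately have "twist L b a (L a n) = 1"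
      using twist_step[OF L ladder_less[OF L a(1)], of b n] by simp
    then show ?thesis
      using n True by (intro exI[of _ n]) simp
  qed
qed

text \<open>The family is \<open>twist\<close> with the least ordinal as bound. For the last property, let \<open>y\<close> be a rung of \<open>a\<close>
  above \<open>x\<close>: the blocks beyond \<open>y\<close> have bounds at least \<open>y\<close>, so \<open>twist_jump\<close> inside such a block
  produces ladder points above \<open>x\<close>.\<close>

lemma exists_coherent_family:
  assumes L: "ladder_system L"
  obtains f :: "omega1 \<Rightarrow> omega1 \<Rightarrow> int" where
    "\<And>a. f a a = 0"
    "\<And>a x. x \<le> a \<Longrightarrow> \<forall>\<^sub>F z in at_left x. f a z = f a x + f x z"
    "\<And>a. a \<in> limit_ordinals \<Longrightarrow> \<forall>\<^sub>F n in sequentially. f a (L a n) = 0"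
    "\<And>a x. a \<in> limit_ordinals \<Longrightarrow> x < a \<Longrightarrow>
       \<exists>y<a. \<forall>t\<in>limit_ordinals. y < t \<and> t < a \<longrightarrow> (\<exists>n. x < L t n \<and> f a (L t n) = f a t + 1)"
proof -
  define b :: omega1 where "b = (LEAST x. True)"
  have b: "b \<le> x" for x unfolding b_def by (rule Least_le) simp
  show thesis
  proof (rule that[of "twist L b"])
    fix a x :: omega1
    show "twist L b a a = 0" by simp
    assume "x \<le> a"
    show "\<forall>\<^sub>F z in at_left x. twist L b a z = twist L b a x + twist L b x z"
    proof (cases "x = b")
      case True
      then show ?thesis using b by (intro at_left_least_omega1) simp
    next
      case False
      then show ?thesis using b[of x] \<open>x \<le> a\<close> by (intro twist_coherent[OF L]) auto
    qed
  next
    fix a :: omega1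
    assume a: "a \<in> limit_ordinals"
    have mono: "strict_mono (L a)" using L a by (simp add: ladder_system_def)
    \<comment> \<open>\<open>L a 0\<close> may be the bound \<open>b\<close> itself and \<open>L a 1\<close> the first rung above it, whose step is counted.\<close>
    have "twist L b a (L a n) = 0" if "2 \<le> n" for n
    proof -
      have "L a 0 < L a 1" "L a 1 < L a n" using mono that by (auto simp: strict_mono_less)
      then have "b < L a 1" using b[of "L a 0"] by simp
      then have ex: "\<exists>r\<in>rungs L a. b < r \<and> r < L a n"
        using a \<open>L a 1 < L a n\<close> by (auto simp: rungs_def)
      have rung: "L a n \<in> rungs L a" using a by (simp add: rungs_def)
      then have "next_rung L a (L a n) = L a n"
        using next_rung(2)[OF L ladder_less[OF L a], of n] next_rung_le[OF rung order_refl]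
        by simp
      then show ?thesis
        using twist_step[OF L ladder_less[OF L a], of b n] ex by simp
    qed
    then show "\<forall>\<^sub>F n in sequentially. twist L b a (L a n) = 0"
      by (auto simp: eventually_sequentially)
  next
    fix a x :: omega1
    assume a: "a \<in> limit_ordinals" and "x < a"
    then obtain n where n: "x < L a n"
      using ladder_exists_greater[OF L] by blast
    have rung: "L a n \<in> rungs L a" using a by (simp add: rungs_def)
    have "\<exists>j. x < L t j \<and> twist L b a (L t j) = twist L b a t + 1"
      if t: "t \<in> limit_ordinals" "L a n < t" "t < a" for t
    proof -
      have "b < t" using b[of x] n t by simp
      then obtain b' v c where B: "b' < t" "t \<le> v" "v < a"
        and eq: "\<And>z. b' < z \<Longrightarrow> z \<le> v \<Longrightarrow> twist L b a z = twist L b' v z + c"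
        and "\<And>r. r \<in> rungs L a \<Longrightarrow> r < t \<Longrightarrow> r \<le> b'"
        using twist_block[OF L _ t(3)] by metis
      then have "L a n \<le> b'" using rung t by simp
      obtain j where j: "b' < L t j" "twist L b' v (L t j) = twist L b' v t + 1"
        using twist_jump[OF L t(1) B(1,2)] by blast
      have "L t j < t" using ladder_less[OF L t(1)] .
      then show ?thesis
        using j eq[of t] eq[of "L t j"] B n \<open>L a n \<le> b'\<close> by (intro exI[of _ j]) auto
    qed
    then show "\<exists>y<a. \<forall>t\<in>limit_ordinals. y < t \<and> t < a \<longrightarrow>
        (\<exists>j. x < L t j \<and> twist L b a (L t j) = twist L b a t + 1)"
      using ladder_less[OF L a] by blast
  qed
qed

section \<open>The bundle of a coherent family\<close>

definition rot :: "nat \<Rightarrow> int \<Rightarrow> nat \<Rightarrow> nat"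
  where "rot m c i = nat ((int i + c) mod int m)"

lemma rot_less: "0 < m \<Longrightarrow> rot m c i < m"
  by (simp add: rot_def nat_less_iff)

lemma int_rot: "0 < m \<Longrightarrow> int (rot m c i) = (int i + c) mod int m"
  by (simp add: rot_def)

lemma rot_rot: "0 < m \<Longrightarrow> rot m c (rot m c' i) = rot m (c + c') i"
  by (simp add: rot_def mod_add_left_eq mod_add_right_eq algebra_simps)

lemma rot_0: "i < m \<Longrightarrow> rot m 0 i = i"
  by (simp add: rot_def)

lemma rot_minus: "0 < m \<Longrightarrow> i < m \<Longrightarrow> rot m c (rot m (- c) i) = i"
  "0 < m \<Longrightarrow> i < m \<Longrightarrow> rot m (- c) (rot m c i) = i"
  by (simp_all add: rot_rot rot_0)

lemma inj_on_rot: "0 < m \<Longrightarrow> inj_on (rot m c) {..<m}"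
  by (rule inj_on_inverseI[where g = "rot m (- c)"]) (simp add: rot_minus)

text \<open>A set is open if with each point \<open>(a, i)\<close> it contains the germ at \<open>a\<close> of the sheet through
  \<open>(a, i)\<close>. At the least ordinal and at successors \<open>at_left\<close> is trivial, so the points over them are
  isolated.\<close>

definition twisted_product :: "nat \<Rightarrow> (omega1 \<Rightarrow> omega1 \<Rightarrow> int) \<Rightarrow> (omega1 \<times> nat) topology"
  where "twisted_product m c = topology (\<lambda>U. U \<subseteq> UNIV \<times> {..<m} \<and>
    (\<forall>a i. (a, i) \<in> U \<longrightarrow> (\<forall>\<^sub>F z in at_left a. (z, rot m (c a z) i) \<in> U)))"

lemma openin_twisted_product:
  "openin (twisted_product m c) U \<longleftrightarrow> U \<subseteq> UNIV \<times> {..<m} \<and>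
    (\<forall>a i. (a, i) \<in> U \<longrightarrow> (\<forall>\<^sub>F z in at_left a. (z, rot m (c a z) i) \<in> U))"
proof -
  have "istopology (\<lambda>U. U \<subseteq> UNIV \<times> {..<m} \<and>
    (\<forall>a i. (a, i) \<in> U \<longrightarrow> (\<forall>\<^sub>F z in at_left a. (z, rot m (c a z) i) \<in> U)))"
    unfolding istopology_def
  proof (intro conjI allI impI)
    fix S T :: "(omega1 \<times> nat) set" and a i
    assume "S \<subseteq> UNIV \<times> {..<m} \<and>
        (\<forall>a i. (a, i) \<in> S \<longrightarrow> (\<forall>\<^sub>F z in at_left a. (z, rot m (c a z) i) \<in> S))"
      "T \<subseteq> UNIV \<times> {..<m} \<and>
        (\<forall>a i. (a, i) \<in> T \<longrightarrow> (\<forall>\<^sub>F z in at_left a. (z, rot m (c a z) i) \<in> T))"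
      "(a, i) \<in> S \<inter> T"
    then show "\<forall>\<^sub>F z in at_left a. (z, rot m (c a z) i) \<in> S \<inter> T"
      by (simp add: eventually_conj)
  next
    fix \<U> :: "(omega1 \<times> nat) set set" and a i
    assume U: "\<forall>U\<in>\<U>. U \<subseteq> UNIV \<times> {..<m} \<and>
        (\<forall>a i. (a, i) \<in> U \<longrightarrow> (\<forall>\<^sub>F z in at_left a. (z, rot m (c a z) i) \<in> U))"
      and "(a, i) \<in> \<Union>\<U>"
    then obtain V where "V \<in> \<U>" "(a, i) \<in> V" by blast
    then have "\<forall>\<^sub>F z in at_left a. (z, rot m (c a z) i) \<in> V" using U by blast
    then show "\<forall>\<^sub>F z in at_left a. (z, rot m (c a z) i) \<in> \<Union>\<U>"
      by (rule eventually_mono) (use \<open>V \<in> \<U>\<close> in blast)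
  qed blast+
  then show ?thesis
    by (simp add: twisted_product_def topology_inverse')
qed

locale coherent_family =
  fixes m :: nat and c :: "omega1 \<Rightarrow> omega1 \<Rightarrow> int"
  assumes m_pos: "0 < m"
    and diagonal: "c a a = 0"
    and coherent: "x \<le> a \<Longrightarrow> \<forall>\<^sub>F z in at_left x. c a z = c a x + c x z"
begin

abbreviation "K \<equiv> twisted_product m c"

lemma topspace_twisted_product: "topspace K = UNIV \<times> {..<m}"
proof -
  have "openin K (UNIV \<times> {..<m})"
    by (simp add: openin_twisted_product rot_less m_pos)
  moreover have "topspace K \<subseteq> UNIV \<times> {..<m}"
    using openin_topspace[of K] unfolding openin_twisted_product by blast
  ultimately show ?thesis
    using openin_subset by blast
qed

definition sheet :: "omega1 \<Rightarrow> nat \<Rightarrow> (omega1 \<times> nat) set"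
  where "sheet a i = {(z, rot m (c a z) i) |z. z \<le> a}"

text \<open>This is where coherence enters: near each of its points the sheet is a germ of the sheet attached
  to that point.\<close>

lemma openin_sheet: "openin K (sheet a i)"
  unfolding openin_twisted_product
proof (intro conjI allI impI)
  show "sheet a i \<subseteq> UNIV \<times> {..<m}"
    using rot_less[OF m_pos] by (auto simp: sheet_def)
  fix x j assume "(x, j) \<in> sheet a i"
  then have x: "x \<le> a" and j: "j = rot m (c a x) i"
    by (auto simp: sheet_def)
  have "\<forall>\<^sub>F z in at_left x. z < x"
    by (simp add: eventually_at_filter)
  then show "\<forall>\<^sub>F z in at_left x. (z, rot m (c x z) j) \<in> sheet a i"
    using coherent[OF x]
  proof eventually_elim
    case (elim z)
    then have "rot m (c x z) j = rot m (c a z) i"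
      by (simp add: j rot_rot m_pos add.commute)
    moreover have "z \<le> a" using elim(1) x by simp
    ultimately show ?case by (auto simp: sheet_def)
  qed
qed

lemma continuous_map_fst: "continuous_map K euclidean fst"
  unfolding continuous_map
proof (intro conjI allI impI)
  fix V :: "omega1 set" assume "openin euclidean V"
  then have "\<forall>a\<in>V. \<forall>\<^sub>F z in at_left a. z \<in> V"
    by (simp add: open_omega1_iff_at_left)
  then show "openin K {x \<in> topspace K. fst x \<in> V}"
    by (auto simp: openin_twisted_product topspace_twisted_product rot_less m_pos)
qed simp

lemma eventually_sheet_notin:
  assumes "closedin K E" "i < m" "(a, i) \<notin> E"
  shows "\<forall>\<^sub>F z in at_left a. (z, rot m (c a z) i) \<notin> E"
proof -
  have "openin K (topspace K - E)" using assms(1) by blast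
  moreover have "(a, i) \<in> topspace K - E"
    using assms by (simp add: topspace_twisted_product)
  ultimately have "\<forall>\<^sub>F z in at_left a. (z, rot m (c a z) i) \<in> topspace K - E"
    unfolding openin_twisted_product by blast
  then show ?thesis by (rule eventually_mono) simp
qed

text \<open>Since fibres are finite, a closed set cannot have, arbitrarily close to \<open>a\<close>, points on sheets through
  points of the fibre of \<open>a\<close> outside the set. Both closedness of the projection and the translation
  formula for fibres of clubs follow from this.\<close>

lemma eventually_fiber_subset:
  assumes "closedin K E"
  shows "\<forall>\<^sub>F z in at_left a. {i. (z, i) \<in> E} \<subseteq> rot m (c a z) ` {i. (a, i) \<in> E}"
proof -
  have "\<forall>\<^sub>F z in at_left a. \<forall>i\<in>{..<m} - {i. (a, i) \<in> E}. (z, rot m (c a z) i) \<notin> E"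
    using eventually_sheet_notin[OF assms] by (intro eventually_ball_finite) auto
  then show ?thesis
  proof (rule eventually_mono)
    fix z assume z: "\<forall>i\<in>{..<m} - {i. (a, i) \<in> E}. (z, rot m (c a z) i) \<notin> E"
    show "{i. (z, i) \<in> E} \<subseteq> rot m (c a z) ` {i. (a, i) \<in> E}"
    proof
      fix i assume i: "i \<in> {i. (z, i) \<in> E}"
      then have "i < m"
        using closedin_subset[OF assms] by (auto simp: topspace_twisted_product)
      define j where "j = rot m (- c a z) i"
      have "j < m" "rot m (c a z) j = i"
        using \<open>i < m\<close> by (simp_all add: j_def rot_less rot_minus m_pos)
      then show "i \<in> rot m (c a z) ` {i. (a, i) \<in> E}"
        using i z by (intro image_eqI[of _ _ j]) auto
    qed
  qed
qed

lemma closed_map_fst: "closed_map K euclidean fst"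
  unfolding closed_map_def
proof (intro allI impI)
  fix E assume E: "closedin K E"
  have "open (- fst ` E)"
    unfolding open_omega1_iff_at_left
  proof
    fix a assume "a \<in> - fst ` E"
    then have "{i. (a, i) \<in> E} = {}" by force
    then show "\<forall>\<^sub>F z in at_left a. z \<in> - fst ` E"
      using eventually_fiber_subset[OF E, of a] by (auto elim!: eventually_mono)
  qed
  then show "closedin euclidean (fst ` E)"
    by (simp add: closed_def)
qed

lemma Hausdorff_twisted_product: "Hausdorff_space K"
  unfolding Hausdorff_space_def
proof (intro allI impI, elim conjE)
  fix p q assume p: "p \<in> topspace K" and q: "q \<in> topspace K" and "p \<noteq> q"
  show "\<exists>U V. openin K U \<and> openin K V \<and> p \<in> U \<and> q \<in> V \<and> disjnt U V"
  proof (cases "fst p = fst q")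
    case True
    obtain a i j where pq: "p = (a, i)" "q = (a, j)"
      using True by (metis prod.collapse)
    then have "i < m" "j < m" "i \<noteq> j"
      using p q \<open>p \<noteq> q\<close> by (auto simp: topspace_twisted_product)
    then have "disjnt (sheet a i) (sheet a j)"
      using inj_onD[OF inj_on_rot[OF m_pos]] by (auto simp: sheet_def disjnt_iff)
    moreover have "p \<in> sheet a i" "q \<in> sheet a j"
      using \<open>i < m\<close> \<open>j < m\<close> by (auto simp: pq sheet_def diagonal rot_0)
    ultimately show ?thesis
      using openin_sheet by blast
  next
    case False
    then obtain U V where "open U" "open V" "fst p \<in> U" "fst q \<in> V" "U \<inter> V = {}"
      using hausdorff by metis
    moreover have "openin K {x \<in> topspace K. fst x \<in> W}" if "open W" for W
      using continuous_map_fst that unfolding continuous_map by simp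
    ultimately show ?thesis
      using p q
      by (intro exI[of _ "{x \<in> topspace K. fst x \<in> U}"] exI[of _ "{x \<in> topspace K. fst x \<in> V}"])
        (auto simp: disjnt_iff)
  qed
qed

lemma cp_twisted_product: "cp_omega1 m K"
  unfolding cp_omega1_def
  using topspace_twisted_product Hausdorff_twisted_product continuous_map_fst closed_map_fst m_pos
  by auto

definition rotation :: "int \<Rightarrow> omega1 \<times> nat \<Rightarrow> omega1 \<times> nat"
  where "rotation g = restrict (\<lambda>(a, i). (a, rot m g i)) (topspace K)"

lemma rotation_apply [simp]: "i < m \<Longrightarrow> rotation g (a, i) = (a, rot m g i)"
  by (simp add: rotation_def topspace_twisted_product)

lemma rotation_in_topspace: "p \<in> topspace K \<Longrightarrow> rotation g p \<in> topspace K"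
  by (auto simp: topspace_twisted_product rot_less m_pos)

lemma continuous_map_rotation: "continuous_map K K (rotation g)"
  unfolding continuous_map
proof (intro conjI allI impI)
  show "rotation g ` topspace K \<subseteq> topspace K"
    using rotation_in_topspace by auto
  fix U assume U: "openin K U"
  show "openin K {p \<in> topspace K. rotation g p \<in> U}"
    unfolding openin_twisted_product
  proof (intro conjI allI impI)
    show "{p \<in> topspace K. rotation g p \<in> U} \<subseteq> UNIV \<times> {..<m}"
      by (auto simp: topspace_twisted_product)
    fix a i assume "(a, i) \<in> {p \<in> topspace K. rotation g p \<in> U}"
    then have "(a, rot m g i) \<in> U" "i < m"
      by (auto simp: topspace_twisted_product)
    then have "\<forall>\<^sub>F z in at_left a. (z, rot m (c a z) (rot m g i)) \<in> U"
      using U unfolding openin_twisted_product by blast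
    then show "\<forall>\<^sub>F z in at_left a. (z, rot m (c a z) i) \<in> {p \<in> topspace K. rotation g p \<in> U}"
      by (rule eventually_mono)
        (simp add: topspace_twisted_product rot_less m_pos rot_rot add.commute)
  qed
qed

lemma continuous_map_action:
  "continuous_map (prod_topology (discrete_topology G) K) K (\<lambda>(g, p). rotation g p)"
  unfolding continuous_map
proof (intro conjI allI impI)
  show "(\<lambda>(g, p). rotation g p) ` topspace (prod_topology (discrete_topology G) K) \<subseteq> topspace K"
    using rotation_in_topspace by auto
  fix U assume U: "openin K U"
  have eq: "{x \<in> topspace (prod_topology (discrete_topology G) K). (case x of (g, p) \<Rightarrow> rotation g p) \<in> U}
      = (\<Union>g\<in>G. {g} \<times> {p \<in> topspace K. rotation g p \<in> U})"
    by auto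
  have "openin (prod_topology (discrete_topology G) K) ({g} \<times> {p \<in> topspace K. rotation g p \<in> U})"
    if "g \<in> G" for g
    using continuous_map_rotation[of g] U that
    unfolding continuous_map openin_prod_Times_iff by auto
  then show "openin (prod_topology (discrete_topology G) K)
      {x \<in> topspace (prod_topology (discrete_topology G) K). (case x of (g, p) \<Rightarrow> rotation g p) \<in> U}"
    unfolding eq by blast
qed

lemma carrier_Zm: "carrier (integer_mod_group m) = {0..<int m}"
  using m_pos by (simp add: carrier_integer_mod_group)

lemma group_action_rotation:
  "group_action (integer_mod_group m) (topspace K) rotation"
proof -
  have rot_mod: "rot m (g mod int m) i = rot m g i" for g i
    by (simp add: rot_def mod_add_right_eq)
  have bij: "rotation g \<in> Bij (topspace K)" for g
    unfolding Bij_def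
  proof (intro IntI CollectI)
    show "rotation g \<in> extensional (topspace K)"
      by (simp add: rotation_def)
    show "bij_betw (rotation g) (topspace K) (topspace K)"
      by (rule bij_betw_byWitness[where f' = "rotation (- g)"])
        (auto simp: topspace_twisted_product rot_less rot_minus m_pos)
  qed
  have hom: "rotation \<in> hom (integer_mod_group m) (BijGroup (topspace K))"
  proof (rule homI)
    fix g h assume "g \<in> carrier (integer_mod_group m)" "h \<in> carrier (integer_mod_group m)"
    have "rotation (g \<otimes>\<^bsub>integer_mod_group m\<^esub> h) = compose (topspace K) (rotation g) (rotation h)"
    proof (rule extensionalityI[of _ "topspace K"])
      fix p assume "p \<in> topspace K"
      then show "rotation (g \<otimes>\<^bsub>integer_mod_group m\<^esub> h) p
          = compose (topspace K) (rotation g) (rotation h) p"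
        using m_pos
        by (auto simp: compose_def topspace_twisted_product rot_less rot_rot rot_mod mult_integer_mod_group)
    qed (auto simp: rotation_def)
    then show "rotation (g \<otimes>\<^bsub>integer_mod_group m\<^esub> h)
        = rotation g \<otimes>\<^bsub>BijGroup (topspace K)\<^esub> rotation h"
      using bij by (simp add: BijGroup_def)
  qed (use bij in \<open>simp add: BijGroup_def\<close>)
  show ?thesis
    unfolding group_action_def group_hom_def group_hom_axioms_def
    using hom group_BijGroup group_integer_mod_group by blast
qed

lemma rot_fiber_transitive:
  assumes "i < m" "j < m"
  shows "\<exists>g\<in>{0..<int m}. rot m g i = j"
  using assms m_pos
  by (intro bexI[of _ "(int j - int i) mod int m"])
    (simp_all add: rot_def mod_add_right_eq)

lemma rot_fiber_free:
  assumes "g \<in> {0..<int m}" "i < m" "rot m g i = i"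
  shows "g = 0"
proof -
  have "int i mod int m = (int i + g) mod int m"
    using assms int_rot[OF m_pos, of g i] by simp
  then have "int m dvd g"
    by (metis add_diff_cancel_left' mod_eq_dvd_iff)
  then show ?thesis
    using assms(1) zdvd_imp_le by force
qed

lemma principal_twisted_product: "principal_Zm_bundle m K"
  unfolding principal_Zm_bundle_def
proof (intro conjI exI allI)
  fix a
  show "\<forall>g\<in>carrier (integer_mod_group m). rotation g ` fiber m a = fiber m a"
  proof
    fix g
    have "rotation g ` fiber m a = Pair a ` (rot m g ` {..<m})"
      by (force simp: fiber_def)
    moreover have "rot m g ` {..<m} = {..<m}"
      using rot_less[OF m_pos] inj_on_rot[OF m_pos] by (intro endo_inj_surj) auto
    ultimately show "rotation g ` fiber m a = fiber m a"
      by (auto simp: fiber_def)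
  qed
  show "\<forall>g\<in>carrier (integer_mod_group m). \<forall>x\<in>fiber m a.
      rotation g x = x \<longrightarrow> g = \<one>\<^bsub>integer_mod_group m\<^esub>"
    unfolding carrier_Zm using rot_fiber_free by (auto simp: fiber_def)
  show "\<forall>x\<in>fiber m a. \<forall>y\<in>fiber m a. \<exists>g\<in>carrier (integer_mod_group m). rotation g x = y"
    unfolding carrier_Zm using rot_fiber_transitive by (auto simp: fiber_def)
qed (rule cp_twisted_product group_action_rotation continuous_map_action)+

lemma eventually_fiber_eq:
  assumes E: "closedin K E" and card: "\<And>a. a \<in> fst ` E \<Longrightarrow> card {i. (a, i) \<in> E} = j"
    and a: "a \<in> fst ` E"
  shows "\<forall>\<^sub>F z in at_left a. z \<in> fst ` E \<longrightarrow>
    {i. (z, i) \<in> E} = rot m (c a z) ` {i. (a, i) \<in> E}"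
  using eventually_fiber_subset[OF E]
proof (rule eventually_mono, intro impI)
  fix z assume sub: "{i. (z, i) \<in> E} \<subseteq> rot m (c a z) ` {i. (a, i) \<in> E}" and z: "z \<in> fst ` E"
  have less: "{i. (a, i) \<in> E} \<subseteq> {..<m}"
    using closedin_subset[OF E] by (auto simp: topspace_twisted_product)
  then have "finite {i. (a, i) \<in> E}"
    by (rule finite_subset) simp
  moreover have "card (rot m (c a z) ` {i. (a, i) \<in> E}) = card {i. (z, i) \<in> E}"
    using card_image[OF inj_on_subset[OF inj_on_rot[OF m_pos] less]] card[OF a] card[OF z] by simp
  ultimately show "{i. (z, i) \<in> E} = rot m (c a z) ` {i. (a, i) \<in> E}"
    using sub by (intro card_subset_eq) auto
qed

end

section \<open>The order of the bundle\<close>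

lemma dvd_rot_iff:
  assumes "0 < m" "d dvd m" "int d dvd c"
  shows "d dvd rot m c i \<longleftrightarrow> d dvd i"
proof -
  have "int d dvd int (rot m c i) \<longleftrightarrow> int d dvd int i + c"
    using assms by (simp add: int_rot dvd_mod_iff)
  also have "\<dots> \<longleftrightarrow> int d dvd int i"
    using assms(3) by (rule dvd_add_left_iff)
  finally show ?thesis by simp
qed

lemma card_multiples_less:
  assumes "0 < d"
  shows "card {i. i < d * k \<and> d dvd i} = k"
proof -
  have "{i. i < d * k \<and> d dvd i} = (*) d ` {..<k}"
    using assms by auto
  moreover have "inj_on ((*) d) {..<k}"
    using assms by (simp add: inj_on_def)
  ultimately show ?thesis
    by (simp add: card_image)
qed

lemma le_card_if_rot_invariant:
  assumes "X \<subseteq> {..<d * k}" "X \<noteq> {}" and inv: "rot (d * k) (int d) ` X = X"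
  shows "k \<le> card X"
proof -
  obtain i where i: "i \<in> X" using assms(2) by blast
  then have im: "i < d * k" using assms(1) by auto
  then have pos: "0 < d * k" by (rule le_less_trans[OF le0])
  define g where "g n = rot (d * k) (int d * int n) i" for n
  have "g n \<in> X" for n
  proof (induction n)
    case 0
    then show ?case using i im by (simp add: g_def rot_0)
  next
    case (Suc n)
    have "g (Suc n) = rot (d * k) (int d) (g n)"
      using pos by (simp add: g_def rot_rot algebra_simps)
    then show ?case using Suc inv by auto
  qed
  moreover have "inj_on g {..<k}"
  proof (rule inj_onI)
    fix n n' assume n: "n \<in> {..<k}" "n' \<in> {..<k}" and "g n = g n'"
    then have "(int i + int d * int n) mod int (d * k) = (int i + int d * int n') mod int (d * k)"
      using int_rot[OF pos] unfolding g_def by metis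
    then have "int d * int k dvd int d * (int n - int n')"
      by (simp add: mod_eq_dvd_iff algebra_simps)
    then have "int k dvd int n - int n'"
      using pos by simp
    then have "int n mod int k = int n' mod int k"
      by (simp add: mod_eq_dvd_iff)
    then show "n = n'" using n by simp
  qed
  moreover have "finite X" using assms(1) finite_subset by blast
  ultimately show ?thesis
    using card_inj_on_le[of g "{..<k}" X] by auto
qed

lemma (in coherent_family) club_of_multiples:
  assumes "d dvd m" "\<And>a z. int d dvd c a z"
  shows "club_in K (UNIV \<times> {i. i < m \<and> d dvd i})"
  unfolding club_in_def
proof
  let ?E = "UNIV \<times> {i. i < m \<and> d dvd i} :: (omega1 \<times> nat) set"
  have "openin K (topspace K - ?E)"
    unfolding openin_twisted_product
    using assms by (auto simp: topspace_twisted_product rot_less m_pos dvd_rot_iff)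
  then show "closedin K ?E"
    by (auto simp: closedin_def topspace_twisted_product)
  have "fst ` ?E = UNIV"
    using m_pos by (force simp: image_iff)
  then show "unbounded_omega1 (fst ` ?E)"
    using omega1_exists_greater by (simp add: unbounded_omega1_def)
qed

text \<open>All guessed \<open>t\<close> in an unbounded set have fibres that are constant along \<open>L t\<close> from a common bound
  \<open>b\<close> on. Comparison with a limit \<open>a\<close> of these \<open>t\<close>, at which the family jumps by one along \<open>L t\<close>,
  shows that the fibre over some \<open>t\<close> is invariant under translation by \<open>d\<close>.\<close>

lemma ladder_guessing_fiber_card_ge:
  fixes f :: "omega1 \<Rightarrow> omega1 \<Rightarrow> int"
  assumes L: "ladder_system L"
    and guess: "\<And>C. club_omega1 C \<Longrightarrow>
          stationary_omega1 {a \<in> limit_ordinals. range (L a) \<subseteq> C}"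
    and coh: "coherent_family (d * k) (\<lambda>a z. int d * f a z)"
    and along: "\<And>a. a \<in> limit_ordinals \<Longrightarrow> \<forall>\<^sub>F n in sequentially. f a (L a n) = 0"
    and jump: "\<And>a x. a \<in> limit_ordinals \<Longrightarrow> x < a \<Longrightarrow>
       \<exists>y<a. \<forall>t\<in>limit_ordinals. y < t \<and> t < a \<longrightarrow> (\<exists>n. x < L t n \<and> f a (L t n) = f a t + 1)"
    and E: "club_in (twisted_product (d * k) (\<lambda>a z. int d * f a z)) E"
    and card: "\<And>a. a \<in> fst ` E \<Longrightarrow> card {i. (a, i) \<in> E} = j"
  shows "k \<le> j"
proof -
  interpret coherent_family "d * k" "\<lambda>a z. int d * f a z" by (fact coh)
  define F where "F a = {i. (a, i) \<in> E}" for a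
  define C where "C = fst ` E"
  have closedE: "closedin K E" using E by (simp add: club_in_def)
  have F_less: "F a \<subseteq> {..<d * k}" for a
    using closedin_subset[OF closedE] by (auto simp: F_def topspace_twisted_product)
  have local: "\<forall>\<^sub>F z in at_left a. z \<in> C \<longrightarrow> F z = rot (d * k) (int d * f a z) ` F a" if "a \<in> C" for a
    using eventually_fiber_eq[OF closedE card] that unfolding C_def F_def by blast
  have closedC: "closed C"
    using closed_map_fst closedE by (auto simp: closed_map_def C_def)
  then have club: "club_omega1 C"
    using E by (simp add: club_omega1_def club_in_def C_def)
  have limit_in_C: "a \<in> C" if "b < a" "\<And>x. x < a \<Longrightarrow> \<exists>z\<in>C. x < z \<and> z < a" for a b
  proof (rule ccontr)
    assume "a \<notin> C"
    then have "\<forall>\<^sub>F z in at_left a. z \<notin> C"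
      using closedC open_omega1_iff_at_left[of "- C"] by (auto simp: closed_def)
    then obtain x where "x < a" "\<forall>z>x. z < a \<longrightarrow> z \<notin> C"
      using eventually_at_left[OF \<open>b < a\<close>] by auto
    then show False using that(2) by blast
  qed
  define G where "G = {a \<in> limit_ordinals. range (L a) \<subseteq> C}"
  have G_subset: "G \<subseteq> C"
  proof
    fix a assume a: "a \<in> G"
    then have lim: "a \<in> limit_ordinals" and LC: "L a n \<in> C" for n
      by (auto simp: G_def)
    show "a \<in> C"
    proof (rule limit_in_C)
      show "L a 0 < a" using ladder_less[OF L lim] .
      show "\<exists>z\<in>C. x < z \<and> z < a" if "x < a" for x
        using ladder_exists_greater[OF L lim that] ladder_less[OF L lim] LC by metis
    qed
  qed
  \<comment> \<open>The regressive function to be pressed down.\<close>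
  have "\<exists>g<t. \<forall>n. g < L t n \<longrightarrow> F (L t n) = F t" if t: "t \<in> G" for t
  proof -
    have lim: "t \<in> limit_ordinals" and LC: "L t n \<in> C" for n
      using t by (auto simp: G_def)
    have at_left: "filterlim (L t) (at_left t) sequentially"
      using L lim ladder_less[OF L lim]
      by (auto simp: filterlim_at ladder_system_def less_imp_neq)
    have "\<forall>\<^sub>F n in sequentially. F (L t n) = rot (d * k) (int d * f t (L t n)) ` F t"
      using eventually_compose_filterlim[OF local at_left] t G_subset LC by auto
    then have "\<forall>\<^sub>F n in sequentially. F (L t n) = F t"
      using along[OF lim]
    proof eventually_elim
      case (elim n)
      have "rot (d * k) 0 i = i" if "i \<in> F t" for i
        using F_less[of t] that by (intro rot_0) auto
      then show ?case using elim by simp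
    qed
    then obtain N where N: "\<And>n. N \<le> n \<Longrightarrow> F (L t n) = F t"
      by (auto simp: eventually_sequentially)
    have "strict_mono (L t)" using L lim by (simp add: ladder_system_def)
    then have "N \<le> n" if "L t N < L t n" for n
      using that by (simp add: strict_mono_less less_imp_le)
    then show ?thesis
      using N ladder_less[OF L lim, of N] by blast
  qed
  then obtain g where g: "\<And>t. t \<in> G \<Longrightarrow> g t < t"
    "\<And>t n. t \<in> G \<Longrightarrow> g t < L t n \<Longrightarrow> F (L t n) = F t"
    by metis
  have "stationary_omega1 G"
    unfolding G_def using guess[OF club] .
  then obtain b where "unbounded_omega1 {t \<in> G. g t \<le> b}"
    using regressive_bounded_unbounded g(1) by blast
  then obtain a where "b < a" and a: "\<And>x. x < a \<Longrightarrow> \<exists>t\<in>{t \<in> G. g t \<le> b}. x < t \<and> t < a"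
    using exists_limit_point_omega1 by blast
  have "a \<in> C"
    using limit_in_C[OF \<open>b < a\<close>] a G_subset by blast
  have a_lim: "a \<in> limit_ordinals"
    unfolding limit_ordinals_def using \<open>b < a\<close> a by blast
  obtain x0 where x0: "x0 < a"
    "\<And>z. x0 < z \<Longrightarrow> z < a \<Longrightarrow> z \<in> C \<Longrightarrow> F z = rot (d * k) (int d * f a z) ` F a"
    using local[OF \<open>a \<in> C\<close>] eventually_at_left[OF \<open>b < a\<close>] by auto
  define x where "x = max x0 b"
  have "x < a" using x0(1) \<open>b < a\<close> by (simp add: x_def)
  obtain y where "y < a"
    and y: "\<And>t. t \<in> limit_ordinals \<Longrightarrow> y < t \<Longrightarrow> t < a \<Longrightarrow> \<exists>n. x < L t n \<and> f a (L t n) = f a t + 1"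
    using jump[OF a_lim \<open>x < a\<close>] by blast
  obtain t where t: "t \<in> G" "g t \<le> b" "max x y < t" "t < a"
    using a[of "max x y"] \<open>x < a\<close> \<open>y < a\<close> by auto
  have t_lim: "t \<in> limit_ordinals" and LC: "L t n \<in> C" for n
    using t(1) by (auto simp: G_def)
  obtain n where n: "x < L t n" "f a (L t n) = f a t + 1"
    using y[OF t_lim] t by auto
  have less: "L t n < a" using ladder_less[OF L t_lim] t(4) by (rule less_trans)
  \<comment> \<open>Two values for the fibre over \<open>L t n\<close>: the ladder at \<open>t\<close> gives \<open>F t\<close>, the sheets of \<open>a\<close> give its
    translate by \<open>d\<close>.\<close>
  have "F t = F (L t n)"
    using g(2)[OF t(1) le_less_trans[OF t(2)], of n] n(1) by (simp add: x_def)
  also have "\<dots> = rot (d * k) (int d * f a (L t n)) ` F a"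
    using n(1) less LC by (intro x0(2)) (auto simp: x_def)
  also have "\<dots> = rot (d * k) (int d) ` rot (d * k) (int d * f a t) ` F a"
    using m_pos by (simp add: n(2) image_image rot_rot algebra_simps)
  also have "rot (d * k) (int d * f a t) ` F a = F t"
    using t G_subset by (intro x0(2)[symmetric]) (auto simp: x_def)
  finally have "rot (d * k) (int d) ` F t = F t" by simp
  moreover have "t \<in> fst ` E" using t(1) G_subset by (auto simp: C_def)
  moreover have "F t \<noteq> {}" using \<open>t \<in> fst ` E\<close> by (auto simp: F_def)
  ultimately show ?thesis
    using le_card_if_rot_invariant[OF F_less[of t]] card[of t] by (simp add: F_def)
qed

theorem theorem6p23:
  fixes k m :: nat
  assumes "clubsuit_C"
    and "0 < k" and "0 < m" and "k dvd m"
  shows "\<exists>K. principal_Zm_bundle m K \<and> cp_order m K = k"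
proof -
  obtain d where m: "m = d * k"
    using assms(4) by (metis dvd_def mult.commute)
  then have "0 < d" using assms(3) by simp
  obtain L where L: "ladder_system L" and guess: "\<And>C. club_omega1 C \<Longrightarrow>
      stationary_omega1 {a \<in> limit_ordinals. range (L a) \<subseteq> C}"
    using assms(1) unfolding clubsuit_C_def by blast
  obtain f :: "omega1 \<Rightarrow> omega1 \<Rightarrow> int" where f: "\<And>a. f a a = 0"
    "\<And>a x. x \<le> a \<Longrightarrow> \<forall>\<^sub>F z in at_left x. f a z = f a x + f x z"
    "\<And>a. a \<in> limit_ordinals \<Longrightarrow> \<forall>\<^sub>F n in sequentially. f a (L a n) = 0"
    "\<And>a x. a \<in> limit_ordinals \<Longrightarrow> x < a \<Longrightarrow>
       \<exists>y<a. \<forall>t\<in>limit_ordinals. y < t \<and> t < a \<longrightarrow> (\<exists>n. x < L t n \<and> f a (L t n) = f a t + 1)"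
    using exists_coherent_family[OF L] by blast
  let ?c = "\<lambda>a z. int d * f a z"
  have coh: "coherent_family (d * k) ?c"
  proof
    show "0 < d * k" using assms(3) m by simp
    fix a x :: omega1
    show "int d * f a a = 0" by (simp add: f(1))
    assume "x \<le> a"
    from f(2)[OF this] show "\<forall>\<^sub>F z in at_left x. int d * f a z = int d * f a x + int d * f x z"
      by (rule eventually_mono) (simp add: distrib_left)
  qed
  interpret coherent_family "d * k" ?c by (fact coh)
  have fiber: "card (E \<inter> fiber m a) = card {i. (a, i) \<in> E}" if "closedin K E" for E a
  proof -
    have "E \<inter> fiber m a = Pair a ` {i. (a, i) \<in> E}"
      using closedin_subset[OF that] by (auto simp: fiber_def topspace_twisted_product m)
    then show ?thesis by (simp add: card_image inj_on_def)
  qed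
  have "cp_order m K = k"
    unfolding cp_order_def
  proof (rule Least_equality)
    let ?E = "UNIV \<times> {i. i < d * k \<and> d dvd i} :: (omega1 \<times> nat) set"
    have E: "club_in K ?E" by (rule club_of_multiples) auto
    then have "card (?E \<inter> fiber m a) = k" for a
      using card_multiples_less[OF \<open>0 < d\<close>, of k] by (subst fiber) (auto simp: club_in_def)
    then show "\<exists>E. club_in K E \<and> (\<forall>a\<in>fst ` E. card (E \<inter> fiber m a) = k)"
      using E by blast
    fix j assume "\<exists>E. club_in K E \<and> (\<forall>a\<in>fst ` E. card (E \<inter> fiber m a) = j)"
    then obtain E where E: "club_in K E" "\<And>a. a \<in> fst ` E \<Longrightarrow> card (E \<inter> fiber m a) = j"
      by blast
    then show "k \<le> j"
      using fiber[of E]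
      by (intro ladder_guessing_fiber_card_ge[OF L guess coh f(3,4) E(1)]) (auto simp: club_in_def)
  qed
  then show ?thesis
    using principal_twisted_product m by auto
qed

end
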